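(* Suppose that $f : \mathbb{N} \rightarrow \mathbb{N}$ is nondecreasing and that there exist $c,\epsilon > 0$ such that for all $n \in \mathbb{N}$, $$f(n) \geq c\, n \log(n) (\log\log n)^{1+\epsilon}.$$ Then there exist a residually finite group $G$, generated by a finite set $S$, and constants $c_1, c_2 > 0$ such that $$f(n/c_1 - c_2) \leq \mathcal{D}_G^S(n) \leq 2 f(c_1 n + c_2)$$ for all $n \in \mathbb{N}$, where the left-hand inequality is asserted for those $n$ with $n/c_1 - c_2 > 0$.
   Context: $\mathbb{N}=\{1,2,3,\dots\}$ and $\log$ is the natural logarithm. For a function $f:\mathbb{N}\to\mathbb{N}$ and a real $x\in(0,\infty)$ that is not an integer, $f(x)$ means $f(\lceil x\rceil)$. The factor $(\log\log n)^{1+\epsilon}$ is read as $0$ for $n\in\{1,2\}$. A group $G$ is residually finite if for every nontrivial $g\in G$ there is a finite-index subgroup of $G$ not containing $g$. For $G$ generated by a finite set $S$, let $B_S(n)=\{s_1\cdots s_m : 0\le m\le n,\ s_i\in S\cup S^{-1}\}$. The depth of a nontrivial $g\in G$ is the minimal index of a finite-index (not necessarily normal) subgroup of $G$ not containing $g$. The divisibility function $\mathcal{D}_G^S:\mathbb{N}\to\mathbb{N}$ is defined by letting $\mathcal{D}_G^S(n)$ be the maximal depth among the nontrivial elements of $B_S(n)$. *)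

theory Defs
  imports Complex_Main "HOL-Algebra.Generated_Groups"
begin

definition finite_index_subgroup :: "'a set \<Rightarrow> ('a, 'b) monoid_scheme \<Rightarrow> bool" where
  "finite_index_subgroup H G \<longleftrightarrow> subgroup H G \<and> finite (rcosets\<^bsub>G\<^esub> H)"

definition residually_finite :: "('a, 'b) monoid_scheme \<Rightarrow> bool" where
  "residually_finite G \<longleftrightarrow>
     group G \<and>
     (\<forall>g\<in>carrier G. g \<noteq> \<one>\<^bsub>G\<^esub> \<longrightarrow> (\<exists>H. finite_index_subgroup H G \<and> g \<notin> H))"

definition word_ball :: "('a, 'b) monoid_scheme \<Rightarrow> 'a set \<Rightarrow> nat \<Rightarrow> 'a set" where
  "word_ball G S n =
     {foldr (\<otimes>\<^bsub>G\<^esub>) ws \<one>\<^bsub>G\<^esub> | ws.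
        length ws \<le> n \<and> set ws \<subseteq> S \<union> (\<lambda>s. inv\<^bsub>G\<^esub> s) ` S}"

definition depth :: "('a, 'b) monoid_scheme \<Rightarrow> 'a \<Rightarrow> nat" where
  "depth G g =
     (LEAST k. \<exists>H. finite_index_subgroup H G \<and> g \<notin> H \<and> k = card (rcosets\<^bsub>G\<^esub> H))"

text \<open>
  If the ball contains no nontrivial element (for \<open>n \<ge> 1\<close> this means that \<open>G\<close> is trivial),
  the maximum is over the empty set and the value carries no information.
\<close>

definition divisibility_function :: "('a, 'b) monoid_scheme \<Rightarrow> 'a set \<Rightarrow> nat \<Rightarrow> nat" where
  "divisibility_function G S n = Max (depth G ` (word_ball G S n - {\<one>\<^bsub>G\<^esub>}))"

text \<open>The value at a real \<open>x > 0\<close> of a function on the positive integers.\<close>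

definition at_real :: "(nat \<Rightarrow> nat) \<Rightarrow> real \<Rightarrow> nat" where
  "at_real f x = f (nat \<lceil>x\<rceil>)"

text \<open>The factor \<open>(log log n)\<^sup>1\<^sup>+\<^sup>\<epsilon>\<close>, whose base is negative or undefined for \<open>n \<le> 2\<close>.\<close>

definition loglog_factor :: "real \<Rightarrow> nat \<Rightarrow> real" where
  "loglog_factor \<epsilon> n = (if n \<le> 2 then 0 else ln (ln (real n)) powr (1 + \<epsilon>))"

end

theory Submission
  imports Defs "HOL-Combinatorics.Transposition" "HOL-Library.Countable_Set"
begin

text \<open>
  The group is generated by two permutations of the disjoint union of the cyclic groups
  \<open>\<int>/m\<^sub>k\<close>: the simultaneous translation by one and the simultaneous transposition of \<open>0\<close> and \<open>a\<^sub>k\<close>.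
  Here \<open>a\<^sub>k = 2\<^sup>i + 1\<close> for \<open>i = k + i\<^sub>0\<close>, and \<open>m\<^sub>k\<close> is the power of two in the half-open interval from
  \<open>f (2\<^sup>i)\<close> (excluded) to \<open>2 f (2\<^sup>i)\<close>.

  Upper bound: a word of length \<open>n\<close> cannot distinguish two cycles on which the two marked points are
  more than \<open>2 n\<close> apart, since on both it acts as in the lamplighter group. So a nontrivial element of
  the \<open>n\<close>-ball acts nontrivially on a cycle with \<open>2\<^sup>i\<close> at most linear in \<open>n\<close>, and a point stabilizer
  has index at most \<open>m\<^sub>k\<close>.

  Lower bound: the commutator of the transposition with its conjugate by the \<open>a\<^sub>k\<close>-th power of the
  translation is a three-cycle on \<open>\<int>/m\<^sub>k\<close> and trivial on all other cycles, because modulo \<open>m\<^sub>j\<close> the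
  number \<open>a\<^sub>k\<close> is none of \<open>0\<close>, \<open>a\<^sub>j\<close>, \<open>- a\<^sub>j\<close> for \<open>j \<noteq> k\<close>. As \<open>a\<^sub>k\<close> is odd and \<open>m\<^sub>k\<close> a power of
  two, the group induces the full symmetric group on \<open>\<int>/m\<^sub>k\<close>, hence contains every three-cycle of
  \<open>\<int>/m\<^sub>k\<close>, and so does each of its subgroups of index less than \<open>m\<^sub>k - 1\<close>.
\<close>

section \<open>Cosets and countable permutation groups\<close>

lemma (in group) card_le_card_rcosets:
  assumes H: "subgroup H G" and fin: "finite (rcosets H)" and F: "F \<subseteq> carrier G"
    and sep: "\<And>a b. a \<in> F \<Longrightarrow> b \<in> F \<Longrightarrow> a \<noteq> b \<Longrightarrow> a \<otimes> inv b \<notin> H"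
  shows "card F \<le> card (rcosets H)"
proof (rule card_inj_on_le[of "\<lambda>a. H #> a"])
  show "inj_on (\<lambda>a. H #> a) F"
  proof (rule inj_onI, rule ccontr)
    fix a b assume ab: "a \<in> F" "b \<in> F" "H #> a = H #> b" "a \<noteq> b"
    then have "a \<in> H #> b" using F rcos_self[OF _ H] by blast
    then obtain h where h: "h \<in> H" "a = h \<otimes> b" by (auto simp: r_coset_def)
    then have "a \<otimes> inv b = h"
      using F ab subgroup.mem_carrier[OF H] by (metis (no_types, lifting) inv_solve_right' subset_iff)
    with h sep[OF ab(1,2,4)] show False by simp
  qed
  show "(\<lambda>a. H #> a) ` F \<subseteq> rcosets H" using F by (auto simp: RCOSETS_def)
qed (rule fin)

text \<open>Orbit-stabilizer argument. Since \<open>X\<close> merely contains the orbit of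
  \<open>p\<close>, an inequality results.\<close>

lemma (in group) stabilizer_finite_index:
  fixes \<phi> :: "'a \<Rightarrow> 'x \<Rightarrow> 'x"
  assumes mult: "\<And>g h. g \<in> carrier G \<Longrightarrow> h \<in> carrier G \<Longrightarrow> \<phi> (g \<otimes> h) = \<phi> g \<circ> \<phi> h"
    and one: "\<phi> \<one> = id"
    and X: "finite X" "\<And>g. g \<in> carrier G \<Longrightarrow> \<phi> g p \<in> X"
  defines "H \<equiv> {g \<in> carrier G. \<phi> g p = p}"
  shows "finite_index_subgroup H G" and "card (rcosets H) \<le> card X"
proof -
  have inv_p: "\<phi> (inv g) (\<phi> g q) = q" if "g \<in> carrier G" for g q
    using mult[of "inv g" g] one that by (metis comp_apply id_apply inv_closed l_inv)
  have H: "subgroup H G"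
  proof
    fix x y assume "x \<in> H" "y \<in> H"
    then show "x \<otimes> y \<in> H" by (auto simp: H_def mult)
  next
    fix x assume "x \<in> H"
    then show "inv x \<in> H" using inv_p[of x p] by (auto simp: H_def)
  qed (auto simp: H_def one)
  \<comment> \<open>The inverse occurs because the cosets are right cosets: \<open>a\<close> and
    \<open>b\<close> share one exactly when \<open>inv a\<close> and \<open>inv b\<close> send
    \<open>p\<close> to the same point.\<close>
  define r where "r q = H #> (SOME a. a \<in> carrier G \<and> \<phi> (inv a) p = q)" for q
  have "rcosets H \<subseteq> r ` X"
  proof
    fix C assume "C \<in> rcosets H"
    then obtain a where a: "a \<in> carrier G" "C = H #> a" by (auto simp: RCOSETS_def)
    define b where "b = (SOME b. b \<in> carrier G \<and> \<phi> (inv b) p = \<phi> (inv a) p)"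
    have b: "b \<in> carrier G" "\<phi> (inv b) p = \<phi> (inv a) p"
      using someI[of "\<lambda>b. b \<in> carrier G \<and> \<phi> (inv b) p = \<phi> (inv a) p" a] a by (auto simp: b_def)
    have "\<phi> (b \<otimes> inv a) p = \<phi> b (\<phi> (inv b) p)" using a b by (simp add: mult)
    also have "\<dots> = p" using inv_p[of "inv b" p] b by simp
    finally have "b \<otimes> inv a \<in> H" using a b by (simp add: H_def)
    moreover have "b = (b \<otimes> inv a) \<otimes> a" using a b by (simp add: m_assoc)
    ultimately have "b \<in> H #> a" by (auto simp: r_coset_def)
    then have "C = H #> b" using repr_independence[OF _ a(1) H] a by simp
    then have "C = r (\<phi> (inv a) p)" by (simp add: r_def b_def)
    then show "C \<in> r ` X" using X(2)[of "inv a"] a by simp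
  qed
  moreover from this have "finite (rcosets H)" using X(1) finite_surj by blast
  ultimately show "finite_index_subgroup H G" "card (rcosets H) \<le> card X"
    using H X(1) surj_card_le by (auto simp: finite_index_subgroup_def)
qed

text \<open>The theorem asks for a group whose elements are natural numbers, so a countable
  permutation group is transported along an enumeration.\<close>

lemma countable_permutation_group_as_nat_group:
  fixes C :: "('a \<Rightarrow> 'a) set"
  assumes "countable C" and one: "id \<in> C"
    and mult: "\<And>g h. g \<in> C \<Longrightarrow> h \<in> C \<Longrightarrow> g \<circ> h \<in> C"
    and inv: "\<And>g. g \<in> C \<Longrightarrow> \<exists>h\<in>C. h \<circ> g = id"
  shows "\<exists>(G :: nat monoid) \<phi>. group G \<and> bij_betw \<phi> (carrier G) C \<and> \<phi> \<one>\<^bsub>G\<^esub> = id \<and>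
    (\<forall>g\<in>carrier G. \<forall>h\<in>carrier G. \<phi> (g \<otimes>\<^bsub>G\<^esub> h) = \<phi> g \<circ> \<phi> h)"
proof -
  define e where "e = to_nat_on C"
  define \<phi> where "\<phi> = from_nat_into C"
  have \<phi>e [simp]: "\<phi> (e g) = g" if "g \<in> C" for g
    using assms(1) that by (simp add: \<phi>_def e_def)
  define G where "G = \<lparr>carrier = e ` C, mult = \<lambda>u v. e (\<phi> u \<circ> \<phi> v), one = e id\<rparr>"
  have "group G"
  proof (rule groupI)
    fix x assume "x \<in> carrier G"
    then obtain g where g: "g \<in> C" "x = e g" by (auto simp: G_def)
    obtain h where "h \<in> C" "h \<circ> g = id" using inv g by blast
    then show "\<exists>y\<in>carrier G. y \<otimes>\<^bsub>G\<^esub> x = \<one>\<^bsub>G\<^esub>" using g by (auto simp: G_def intro!: bexI[of _ h])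
  qed (auto simp: G_def one mult comp_assoc)
  moreover have "bij_betw \<phi> (carrier G) C"
    by (rule bij_betwI[where g = e]) (auto simp: G_def)
  ultimately show ?thesis
    by (intro exI[of _ G] exI[of _ \<phi>]) (auto simp: G_def one mult)
qed

section \<open>Three-cycles in subgroups of small index\<close>

text \<open>A product of transpositions, so that conjugation reduces to
  \<open>comp_transpose\<close>.\<close>

definition three_cycle :: "'a \<Rightarrow> 'a \<Rightarrow> 'a \<Rightarrow> 'a \<Rightarrow> 'a" where
  "three_cycle i j l = transpose i j \<circ> transpose j l"

lemma comp_transpose: "inj h \<Longrightarrow> h \<circ> transpose i j = transpose (h i) (h j) \<circ> h"
  by (auto simp: fun_eq_iff transpose_def inj_eq)

lemma conj_three_cycle:
  assumes "inj h" "h \<circ> h' = id"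
  shows "h \<circ> three_cycle i j l \<circ> h' = three_cycle (h i) (h j) (h l)"
proof -
  have "h \<circ> three_cycle i j l \<circ> h' = three_cycle (h i) (h j) (h l) \<circ> (h \<circ> h')"
    by (simp add: three_cycle_def comp_transpose[OF assms(1)] flip: comp_assoc)
       (simp add: comp_assoc comp_transpose[OF assms(1)])
  then show ?thesis using assms(2) by simp
qed

lemma three_cycle_apply:
  assumes "distinct [i, j, l]"
  shows "three_cycle i j l i = j" "three_cycle i j l j = l" "three_cycle i j l l = i"
    "p \<noteq> i \<Longrightarrow> p \<noteq> j \<Longrightarrow> p \<noteq> l \<Longrightarrow> three_cycle i j l p = p"
  using assms by (auto simp: three_cycle_def transpose_def)

lemma three_cycle_rotate: "distinct [i, j, l] \<Longrightarrow> three_cycle j l i = three_cycle i j l"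
  by (auto simp: three_cycle_def transpose_def fun_eq_iff)

lemma three_cycle_square: "distinct [i, j, l] \<Longrightarrow> three_cycle i j l \<circ> three_cycle i j l = three_cycle i l j"
  by (auto simp: three_cycle_def transpose_def fun_eq_iff)

lemma three_cycle_inverse: "three_cycle l j i \<circ> three_cycle i j l = id"
  by (auto simp: three_cycle_def fun_eq_iff transpose_commute)

lemma inv_three_cycle: "Hilbert_Choice.inv (three_cycle i j l) = three_cycle l j i"
  by (rule inv_unique_comp) (rule three_cycle_inverse)+

section \<open>Permutation groups and the three-cycles they contain\<close>

definition permutation_group :: "('a \<Rightarrow> 'a) set \<Rightarrow> bool" where
  "permutation_group H \<longleftrightarrow> id \<in> H \<and> (\<forall>g\<in>H. bij g \<and> Hilbert_Choice.inv g \<in> H) \<and> (\<forall>g\<in>H. \<forall>h\<in>H. g \<circ> h \<in> H)"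

locale perm_group =
  fixes H :: "('a \<Rightarrow> 'a) set"
  assumes pg: "permutation_group H"
begin

definition triple :: "'a \<Rightarrow> 'a \<Rightarrow> 'a \<Rightarrow> bool" where
  "triple i j l \<longleftrightarrow> distinct [i, j, l] \<and> three_cycle i j l \<in> H"

lemma triple_rotate: "triple i j l \<Longrightarrow> triple j l i"
  by (auto simp: triple_def three_cycle_rotate)

text \<open>The square of a three-cycle is the opposite cycle. Together with
  \<open>triple_rotate\<close>, \<open>triple\<close> depends only on the set of its three
  points.\<close>

lemma triple_swap: "triple i j l \<Longrightarrow> triple i l j"
  unfolding triple_def using pg three_cycle_square[of i j l] by (metis distinct_length_2_or_more distinct_singleton permutation_group_def)

lemma triple_image:
  assumes "h \<in> H" "triple i j l" shows "triple (h i) (h j) (h l)"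
proof -
  have h: "bij h" "Hilbert_Choice.inv h \<in> H" using pg assms by (auto simp: permutation_group_def)
  have "h \<circ> three_cycle i j l \<circ> Hilbert_Choice.inv h \<in> H"
    using pg h assms by (auto simp: permutation_group_def triple_def)
  moreover have "h \<circ> Hilbert_Choice.inv h = id" using h by (simp add: bij_is_surj flip: surj_iff)
  ultimately show ?thesis
    using h assms conj_three_cycle[of h "Hilbert_Choice.inv h" i j l]
    by (simp add: triple_def bij_is_inj inj_eq)
qed

lemma triple_apply: "triple s l t \<Longrightarrow> triple i j k \<Longrightarrow> triple (three_cycle s l t i) (three_cycle s l t j) (three_cycle s l t k)"
  using triple_image[of "three_cycle s l t"] by (auto simp: triple_def)

definition linked :: "'a \<Rightarrow> 'a \<Rightarrow> bool" where
  "linked i j \<longleftrightarrow> i = j \<or> (\<exists>l. triple i j l)"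

lemma linked_sym: "linked i j \<Longrightarrow> linked j i"
  unfolding linked_def using triple_rotate triple_swap by blast

text \<open>Let \<open>l\<close> be the third point of a cycle through \<open>i\<close> and
  \<open>j\<close>. If \<open>k\<close> is not \<open>l\<close>, conjugating a cycle through
  \<open>j\<close> and \<open>k\<close> by \<open>three_cycle l j i\<close> carries \<open>j\<close>
  to \<open>i\<close> and fixes \<open>k\<close>.\<close>

lemma linked_trans:
  assumes "linked i j" "linked j k" shows "linked i k"
proof (cases "i = j \<or> j = k \<or> i = k")
  case False
  then obtain l l' where l: "triple i j l" "triple j k l'" using assms by (auto simp: linked_def)
  show ?thesis
  proof (cases "k = l")
    case True then show ?thesis using l triple_swap by (auto simp: linked_def)
  next
    case k: False
    have "triple l j i" using l triple_rotate triple_swap by blast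
    then have "triple (three_cycle l j i j) (three_cycle l j i k) (three_cycle l j i l')"
      using l(2) triple_apply by blast
    moreover have "three_cycle l j i j = i" "three_cycle l j i k = k"
      using \<open>triple l j i\<close> False k by (auto simp: triple_def three_cycle_apply)
    ultimately show ?thesis by (auto simp: linked_def)
  qed
qed (use assms in \<open>auto simp: linked_def\<close>)

lemma linked_image: "h \<in> H \<Longrightarrow> linked i j \<Longrightarrow> linked (h i) (h j)"
  unfolding linked_def using triple_image by blast

text \<open>A third point \<open>s\<close> of a cycle through \<open>i\<close> and \<open>j\<close>
  is linked to \<open>l\<close>. Conjugating by a cycle that sends \<open>s\<close> to
  \<open>l\<close> replaces \<open>s\<close> by \<open>l\<close>, provided that \<open>i\<close> and
  \<open>j\<close> are fixed.\<close>

lemma triple_if_linked: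
  assumes "distinct [i, j, l]" "linked i j" "linked j l" shows "triple i j l"
proof -
  obtain s where s: "triple i j s" using assms by (auto simp: linked_def)
  show ?thesis
  proof (cases "s = l")
    case False
    have "linked s j" using triple_swap[OF triple_rotate[OF triple_rotate[OF s]]] by (auto simp: linked_def)
    then have "linked s l" using assms(3) by (rule linked_trans)
    then obtain t where t: "triple s l t" using False by (auto simp: linked_def)
    have d: "distinct [s, l, t]" "distinct [i, j, s]" using s t by (auto simp: triple_def)
    have 1: "triple (three_cycle s l t i) (three_cycle s l t j) (three_cycle s l t s)"
      using triple_apply[OF t s] .
    \<comment> \<open>Conjugating twice settles the case that \<open>t\<close> is \<open>i\<close>
      or \<open>j\<close>: then \<open>t\<close> goes to \<open>l\<close> by way of
      \<open>s\<close>, and \<open>s\<close> goes to \<open>t\<close>, while the other of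
      \<open>i\<close> and \<open>j\<close> is fixed.\<close>
    have 2: "triple (three_cycle s l t (three_cycle s l t i)) (three_cycle s l t (three_cycle s l t j))
        (three_cycle s l t (three_cycle s l t s))"
      using triple_apply[OF t 1] .
    show ?thesis
    proof (cases "t = i \<or> t = j")
      case False
      then show ?thesis
        using 1 d assms three_cycle_apply(1)[of s l t] three_cycle_apply(4)[of s l t i]
          three_cycle_apply(4)[of s l t j] by auto
    next
      case True
      then have "triple l j i \<or> triple i l j"
      proof
        assume "t = i"
        moreover from this have "three_cycle s l t j = j" using d assms three_cycle_apply(4)[of s l t j] by auto
        ultimately show ?thesis using 2 d three_cycle_apply(1-3)[of s l t] by simp
      next
        assume "t = j"
        moreover from this have "three_cycle s l t i = i" using d assms three_cycle_apply(4)[of s l t i] by auto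
        ultimately show ?thesis using 2 d three_cycle_apply(1-3)[of s l t] by simp
      qed
      then show ?thesis using triple_rotate triple_swap by blast
    qed
  qed (use s in simp)
qed

end

text \<open>Two points are linked if they are equal or lie on a common three-cycle of \<open>H\<close>; this is an
  \<open>H\<close>-invariant equivalence relation. Comparing the three-cycles through two fixed points yields a
  class \<open>C\<close> with at least three points. If \<open>C \<noteq> X\<close>, the transpositions exchanging a point of \<open>C\<close> with
  a point outside of \<open>C\<close> lie in pairwise distinct cosets of \<open>H\<close>, and there are too many of them.\<close>

lemma three_cycles_mem_if_small_index:
  fixes \<G> H :: "('a \<Rightarrow> 'a) set"
  assumes G: "permutation_group \<G>" and H: "permutation_group H" and X: "finite X"
    and cyc: "\<And>i j l. \<lbrakk>i \<in> X; j \<in> X; l \<in> X; distinct [i, j, l]\<rbrakk> \<Longrightarrow> three_cycle i j l \<in> \<G>"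
    and tra: "\<And>i j. \<lbrakk>i \<in> X; j \<in> X\<rbrakk> \<Longrightarrow> \<exists>g\<in>\<G>. \<forall>p\<in>X. g p = transpose i j p"
    and index: "\<And>F. \<lbrakk>finite F; F \<subseteq> \<G>; \<And>a b. \<lbrakk>a \<in> F; b \<in> F; a \<noteq> b\<rbrakk> \<Longrightarrow> a \<circ> Hilbert_Choice.inv b \<notin> H\<rbrakk>
       \<Longrightarrow> Suc (card F) < card X"
    and ijl: "i \<in> X" "j \<in> X" "l \<in> X" "distinct [i, j, l]"
  shows "three_cycle i j l \<in> H"
proof -
  interpret perm_group H by unfold_locales (rule H)
  have ij: "i \<noteq> j" using ijl by simp
  have "\<exists>u v w. u \<in> X \<and> v \<in> X \<and> w \<in> X \<and> triple u v w"
  proof (rule ccontr)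
    assume no: "\<not> ?thesis"
    \<comment> \<open>These \<open>card X - 1\<close> elements differ pairwise by three-cycles on
      \<open>X\<close>; with none of those in \<open>H\<close>, they would violate the index
      bound.\<close>
    define F where "F = insert id (three_cycle i j ` (X - {i, j}))"
    have "inj_on (three_cycle i j) (X - {i, j})"
    proof (rule inj_onI)
      fix x y assume "x \<in> X - {i, j}" "y \<in> X - {i, j}" "three_cycle i j x = three_cycle i j y"
      then show "x = y" using ij three_cycle_apply(2)[of i j x] three_cycle_apply(2)[of i j y] by auto
    qed
    moreover have "id \<notin> three_cycle i j ` (X - {i, j})"
    proof
      assume "id \<in> three_cycle i j ` (X - {i, j})"
      then obtain x where "x \<in> X - {i, j}" "id = three_cycle i j x" by auto
      then show False using ij three_cycle_apply(1)[of i j x] by (metis Diff_iff distinct.simps(2)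
        distinct_singleton empty_iff empty_set id_apply insert_iff list.simps(15))
    qed
    ultimately have "card F = Suc (card X - 2)"
      using X ijl ij by (simp add: F_def card_image card_Diff_subset)
    moreover have "card X \<ge> 2" using card_mono[OF X, of "{i, j}"] ijl ij by simp
    moreover have "Suc (card F) < card X"
    proof (rule index)
      show "finite F" using X by (simp add: F_def)
      show "F \<subseteq> \<G>" using cyc ijl G by (auto simp: F_def permutation_group_def)
      fix a b assume ab: "a \<in> F" "b \<in> F" "a \<noteq> b"
      have no1: "three_cycle u v w \<notin> H" if "u \<in> X" "v \<in> X" "w \<in> X" "distinct [u, v, w]" for u v w
        using no that by (auto simp: triple_def)
      consider (1) x where "a = id" "b = three_cycle i j x" "x \<in> X - {i, j}"
        | (2) x where "b = id" "a = three_cycle i j x" "x \<in> X - {i, j}"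
        | (3) x y where "a = three_cycle i j x" "b = three_cycle i j y" "x \<in> X - {i, j}" "y \<in> X - {i, j}" "x \<noteq> y"
        using ab by (auto simp: F_def)
      then show "a \<circ> Hilbert_Choice.inv b \<notin> H"
      proof cases
        case 1
        then show ?thesis using no1[of x j i] ijl ij by (auto simp: inv_three_cycle)
      next
        case 2
        then show ?thesis using no1[of i j x] ijl ij by auto
      next
        case 3
        \<comment> \<open>The quotient is the conjugate of (j x)(j y) by (i j), namely
          \<open>three_cycle i y x\<close>.\<close>
        then have "a \<circ> Hilbert_Choice.inv b
            \<in> {three_cycle j x y, three_cycle i x y, three_cycle i y x, three_cycle j y x}"
          using ij by (auto simp: inv_three_cycle) (auto simp: three_cycle_def fun_eq_iff transpose_def)
        then show ?thesis using no1 3 ijl ij by auto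
      qed
    qed
    ultimately show False by simp
  qed
  then obtain u v w where uvw: "u \<in> X" "v \<in> X" "w \<in> X" "triple u v w" by blast
  define C where "C = {p \<in> X. linked u p}"
  have C3: "{u, v, w} \<subseteq> C" "card {u, v, w} = 3"
    using uvw triple_swap[OF uvw(4)] by (auto simp: C_def linked_def triple_def)
  have "finite C" using X by (simp add: C_def)
  then have cO: "card C \<ge> 3" using card_mono[of C "{u, v, w}"] C3 by simp
  have "C = X"
  proof (rule ccontr)
    assume "C \<noteq> X"
    then have "C \<subset> X" by (auto simp: C_def)
    then have ltX: "card C < card X" using X psubset_card_mono by blast
    \<comment> \<open>These elements are known to be transpositions on \<open>X\<close> only, so
      everything below is evaluated at points of \<open>X\<close>.\<close>
    define g where "g p q = (SOME h. h \<in> \<G> \<and> (\<forall>z\<in>X. h z = transpose p q z))" for p q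
    have g: "g p q \<in> \<G>" "z \<in> X \<Longrightarrow> g p q z = transpose p q z" if "p \<in> X" "q \<in> X" for p q z
      using someI_ex[of "\<lambda>h. h \<in> \<G> \<and> (\<forall>z\<in>X. h z = transpose p q z)"] tra that unfolding g_def by blast+
    have sep: "g p q \<circ> Hilbert_Choice.inv (g p' q') \<notin> H"
      if pq: "p \<in> C" "p' \<in> C" "q \<in> X - C" "q' \<in> X - C" and ne: "(p, q) \<noteq> (p', q')" for p q p' q'
    proof
      define h where "h = g p q \<circ> Hilbert_Choice.inv (g p' q')"
      assume "g p q \<circ> Hilbert_Choice.inv (g p' q') \<in> H"
      then have h: "h \<in> H" by (simp add: h_def)
      have X': "p \<in> X" "p' \<in> X" "q \<in> X" "q' \<in> X" using pq by (auto simp: C_def)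
      have hz: "h z = transpose p q (transpose p' q' z)" if "z \<in> X" for z
      proof -
        have tz: "transpose p' q' z \<in> X" using that X' by (auto simp: transpose_def)
        then have "g p' q' (transpose p' q' z) = z" using g(2) X' by simp
        then have "Hilbert_Choice.inv (g p' q') z = transpose p' q' z"
          using g(1)[OF X'(2,4)] G by (metis bij_is_inj inv_f_eq permutation_group_def)
        then show ?thesis using g(2) X' tz by (simp add: h_def)
      qed
      \<comment> \<open>The class has at least three points, so \<open>h\<close> fixes some point
        \<open>r\<close> of it. By invariance of \<open>linked\<close>, \<open>h\<close> then cannot
        lead from \<open>C\<close> to the rest of \<open>X\<close>, but it moves \<open>p\<close> or
        \<open>p'\<close> there.\<close>
      have "\<exists>r\<in>C. r \<noteq> p \<and> r \<noteq> p'"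
      proof (rule ccontr)
        assume "\<not> ?thesis"
        then have "C \<subseteq> {p, p'}" by blast
        then have "card C \<le> card {p, p'}" by (intro card_mono) auto
        also have "\<dots> \<le> 2" by (simp add: card_insert_if)
        finally show False using cO by simp
      qed
      then obtain r where r: "r \<in> C" "r \<noteq> p" "r \<noteq> p'" by blast
      have hr: "h r = r" using hz[of r] r pq by (auto simp: C_def transpose_def)
      have stay: "h z \<in> C" if "z \<in> C" "h z \<in> X" for z
      proof -
        have "linked r z" using r that linked_trans[OF linked_sym, of u r z] by (auto simp: C_def)
        then have "linked r (h z)" using linked_image[OF h] hr by metis
        then show ?thesis using r that linked_trans[of u r "h z"] by (auto simp: C_def)
      qed
      have "h p \<in> X" "h p' \<in> X" using hz X' by (auto simp: transpose_def)
      then have "h p \<in> C" "h p' \<in> C" using stay pq by auto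
      moreover have "h p \<notin> C \<or> h p' \<notin> C"
        using hz[of p] hz[of p'] X' pq ne by (auto simp: transpose_def split: if_splits)
      ultimately show False by blast
    qed
    define F where "F = (\<lambda>(p, q). g p q) ` (C \<times> (X - C))"
    have "inj_on (\<lambda>(p, q). g p q) (C \<times> (X - C))"
    proof (rule inj_onI, clarify)
      fix p q p' q' assume A: "p \<in> C" "q \<in> X" "q \<notin> C" "p' \<in> C" "q' \<in> X" "q' \<notin> C" "g p q = g p' q'"
      then have "g p q \<in> \<G>" using g by (auto simp: C_def)
      then have "g p q \<circ> Hilbert_Choice.inv (g p' q') \<in> H"
        using A G H by (metis bij_is_surj permutation_group_def surj_iff)
      then show "p = p' \<and> q = q'" using sep[of p p' q q'] A by auto
    qed
    then have "card F = card C * (card X - card C)"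
      using X \<open>finite C\<close> \<open>C \<subset> X\<close> by (simp add: F_def card_image card_Diff_subset card_cartesian_product)
    moreover have "Suc (card F) < card X"
    proof (rule index)
      show "finite F" using X \<open>finite C\<close> by (auto simp: F_def)
      show "F \<subseteq> \<G>" using g by (auto simp: F_def C_def)
      show "a \<circ> Hilbert_Choice.inv b \<notin> H" if ab: "a \<in> F" "b \<in> F" "a \<noteq> b" for a b
        using ab sep by (auto simp: F_def)
    qed
    \<comment> \<open>As \<open>C\<close> has at least three points, the product of the two
      cardinalities is at least \<open>card X - 1\<close>, contrary to the index bound.\<close>
    moreover obtain r where "card X = card C + Suc r" using ltX less_iff_Suc_add by auto
    moreover have "3 * r \<le> card C * r" using cO by (rule mult_le_mono1)
    ultimately show False using cO by (simp add: algebra_simps)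
  qed
  then have "linked u i" "linked u j" "linked u l" using ijl by (auto simp: C_def)
  then have "linked i j" "linked j l" using linked_trans[OF linked_sym] by blast+
  then show ?thesis using triple_if_linked ijl(4) by (auto simp: triple_def)
qed

section \<open>Words acting on a cycle with two marked points\<close>

text \<open>The letter \<open>0\<close> encodes the transposition, \<open>1\<close> and
  \<open>-1\<close> the translation and its inverse, so negating a letter inverts its action. Fixing
  the points off the cycle makes each letter a permutation of all integers.\<close>

definition letter_act :: "int \<Rightarrow> int \<Rightarrow> int \<Rightarrow> int \<Rightarrow> int" where
  "letter_act m a d p =
     (if 0 \<le> p \<and> p < m then if d = 0 then transpose 0 a p else (p + d) mod m else p)"

definition word_act :: "int \<Rightarrow> int \<Rightarrow> int list \<Rightarrow> int \<Rightarrow> int" where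
  "word_act m a w = foldr (letter_act m a) w"

lemma word_act_Nil [simp]: "word_act m a [] = id"
  and word_act_Cons: "word_act m a (d # w) = letter_act m a d \<circ> word_act m a w"
  and word_act_append: "word_act m a (u @ v) = word_act m a u \<circ> word_act m a v"
  by (simp_all add: word_act_def fun_eq_iff)

definition words :: "int list set" where
  "words = lists {-1, 0, 1}"

definition word_inv :: "int list \<Rightarrow> int list" where
  "word_inv w = rev (map uminus w)"

lemma words_simps [simp]: "[] \<in> words" "u @ v \<in> words \<longleftrightarrow> u \<in> words \<and> v \<in> words"
    "d # v \<in> words \<longleftrightarrow> d \<in> {-1, 0, 1} \<and> v \<in> words"
  by (auto simp: words_def)

lemma word_inv_in_words [simp]: "word_inv u \<in> words \<longleftrightarrow> u \<in> words"
proof -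
  have "- d \<in> {-1, 0, 1} \<longleftrightarrow> d \<in> {-1, 0, 1}" for d :: int by auto
  then show ?thesis by (induction u) (auto simp: words_def word_inv_def)
qed

lemma word_inv_inv [simp]: "word_inv (word_inv w) = w"
  by (simp add: word_inv_def rev_map comp_def)

lemma length_word_inv [simp]: "length (word_inv w) = length w"
  by (simp add: word_inv_def)

lemma abs_sum_list_le_length: "w \<in> words \<Longrightarrow> \<bar>sum_list w\<bar> \<le> int (length w)"
  by (induction w) auto

locale marked_cycle =
  fixes m a :: int
  assumes a_pos: "0 < a" and a_less: "a < m"
begin

lemma letter_act_range: "letter_act m a d p \<in> {0..<m} \<longleftrightarrow> p \<in> {0..<m}"
  using a_pos a_less by (auto simp: letter_act_def transpose_def)

lemma word_act_range: "word_act m a w p \<in> {0..<m} \<longleftrightarrow> p \<in> {0..<m}"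
  by (induction w) (use letter_act_range in \<open>auto simp: word_act_Cons\<close>)

lemma word_act_outside: "p \<notin> {0..<m} \<Longrightarrow> word_act m a w p = p"
  by (induction w) (auto simp: word_act_Cons letter_act_def)

lemma letter_act_neg: "letter_act m a (- d) \<circ> letter_act m a d = id"
proof
  fix p show "(letter_act m a (- d) \<circ> letter_act m a d) p = id p"
    using a_pos a_less by (auto simp: letter_act_def transpose_def mod_simps)
qed

lemma word_act_inv: "word_act m a (word_inv w) \<circ> word_act m a w = id"
proof (induction w)
  case (Cons d w)
  have "word_act m a (word_inv (d # w)) \<circ> word_act m a (d # w)
      = word_act m a (word_inv w) \<circ> (letter_act m a (- d) \<circ> letter_act m a d) \<circ> word_act m a w"
    by (simp add: word_inv_def word_act_append word_act_Cons comp_assoc)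
  then show ?case using Cons by (simp add: letter_act_neg)
qed (simp add: word_inv_def)

lemma word_act_inv': "word_act m a w \<circ> word_act m a (word_inv w) = id"
  using word_act_inv[of "word_inv w"] by simp

lemma inj_word_act: "inj (word_act m a w)"
  by (rule inj_on_inverseI[where g = "word_act m a (word_inv w)"])
     (use word_act_inv[of w] in \<open>simp add: fun_eq_iff\<close>)

section \<open>Transpositions represented by words\<close>

definition shift_word :: "int \<Rightarrow> int list" where
  "shift_word t = replicate (nat \<bar>t\<bar>) (sgn t)"

lemma shift_word [simp]: "shift_word t \<in> words" "int (length (shift_word t)) = \<bar>t\<bar>"
  by (auto simp: shift_word_def words_def sgn_if)

lemma word_act_shift:
  assumes "p \<in> {0..<m}" shows "word_act m a (shift_word t) p = (p + t) mod m"
proof -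
  have "word_act m a (replicate n s) p = (p + int n * s) mod m" if "s \<noteq> 0" for n s
  proof (induction n)
    case (Suc n)
    then have "word_act m a (replicate (Suc n) s) p = ((p + int n * s) mod m + s) mod m"
      using a_pos a_less that by (simp add: word_act_Cons letter_act_def)
    then show ?case by (simp add: mod_simps algebra_simps)
  qed (use assms in simp)
  from this[of "sgn t" "nat \<bar>t\<bar>"] show ?thesis
    using assms by (cases "t = 0") (simp_all add: shift_word_def abs_mult_sgn sgn_0_0)
qed

lemma letter_act_zero: "letter_act m a 0 = transpose 0 a"
  using a_pos a_less by (auto simp: letter_act_def transpose_def fun_eq_iff)

lemma word_act_conj_zero:
  "word_act m a (v @ [0] @ word_inv v) = transpose (word_act m a v 0) (word_act m a v a)"
proof -
  have "word_act m a (v @ [0] @ word_inv v) = word_act m a v \<circ> transpose 0 a \<circ> word_act m a (word_inv v)"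
    by (simp add: word_act_append word_act_Cons letter_act_zero comp_assoc)
  also have "\<dots> = transpose (word_act m a v 0) (word_act m a v a)
      \<circ> (word_act m a v \<circ> word_act m a (word_inv v))"
    by (simp add: comp_transpose[OF inj_word_act] comp_assoc)
  finally show ?thesis by (simp add: word_act_inv')
qed

lemma transposition_trans:
  assumes "u \<in> words" "v \<in> words" "word_act m a u = transpose i j" "word_act m a v = transpose j l"
  shows "\<exists>w\<in>words. word_act m a w = transpose i l"
proof (cases "i = l \<or> j = l")
  case True
  then show ?thesis using assms by (metis transpose_same word_act_Nil words_simps(1))
next
  case False
  then have "word_act m a (u @ v @ u) = transpose i l"
    using assms transpose_comp_triple[of i l j] by (simp add: word_act_append comp_assoc)
  then show ?thesis using assms by (metis words_simps(2))
qed

text \<open>Conjugating by translations gives the transpositions of points at distance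
  \<open>a\<close>. These are chained along \<open>i\<close>, \<open>i + a\<close>,
  \<open>i + 2 a\<close> and so on, which meets every residue because \<open>a\<close> is a unit
  modulo \<open>m\<close>.\<close>

lemma ex_word_transposition:
  assumes "coprime a m" "i \<in> {0..<m}" "j \<in> {0..<m}"
  shows "\<exists>w\<in>words. word_act m a w = transpose i j"
proof -
  have step: "\<exists>w\<in>words. word_act m a w = transpose i ((i + a) mod m)" if "i \<in> {0..<m}" for i
    using word_act_conj_zero[of "shift_word i"] that a_pos a_less
    by (intro bexI[of _ "shift_word i @ [0] @ word_inv (shift_word i)"])
       (simp_all add: word_act_shift add.commute)
  have multi: "\<exists>w\<in>words. word_act m a w = transpose i ((i + int n * a) mod m)" for n
  proof (induction n)
    case 0 then show ?case using assms by (intro bexI[of _ "[]"]) auto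
  next
    case (Suc n)
    have "((i + int n * a) mod m + a) mod m = (i + int (Suc n) * a) mod m"
      by (simp add: mod_simps algebra_simps)
    moreover have "(i + int n * a) mod m \<in> {0..<m}" using a_pos a_less by simp
    ultimately show ?case
      using Suc step[of "(i + int n * a) mod m"] transposition_trans by metis
  qed
  \<comment> \<open>\<open>x\<close> inverts \<open>a\<close> modulo \<open>m\<close>, so
    \<open>(j - i) * x\<close> steps of length \<open>a\<close> lead from \<open>i\<close> to
    \<open>j\<close>.\<close>
  obtain x y where xy: "x * a + y * m = 1" using assms(1) bezout_int[of a m] by auto
  define n where "n = nat (((j - i) * x) mod m)"
  have n: "int n = ((j - i) * x) mod m" using a_pos a_less by (simp add: n_def)
  have "(i + int n * a) mod m = (i + (j - i) * x * a) mod m"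
    unfolding n by (metis mod_add_right_eq mod_mult_left_eq)
  also have "(j - i) * x * a = (j - i) * (x * a)" by (simp only: mult.assoc)
  also have "x * a = 1 - y * m" using xy by simp
  also have "i + (j - i) * (1 - y * m) = j + m * (- (j - i) * y)" by (simp add: algebra_simps)
  also have "(j + m * (- (j - i) * y)) mod m = j" using assms by (simp add: mod_simps)
  finally show ?thesis using multi[of n] by simp
qed

end

section \<open>Comparison with infinitely distant marked points\<close>

text \<open>The action of a letter in the limit where the two marked points are infinitely far apart:
  \<open>(e, j)\<close> is the point at signed distance \<open>j\<close> from the marked point number \<open>e\<close>.\<close>

definition limit_act :: "int \<Rightarrow> bool \<times> int \<Rightarrow> bool \<times> int" where
  "limit_act d = (\<lambda>(e, j). if d = 0 then (e \<noteq> (j = 0), j) else (e, j + d))"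

lemma snd_limit_act: "snd (foldr limit_act w (e, j)) = j + sum_list w"
  by (induction w) (auto simp: limit_act_def split_beta)

context marked_cycle
begin

text \<open>\<open>False\<close> stands for the marked point \<open>0\<close>, \<open>True\<close>
  for the marked point \<open>a\<close>.\<close>

definition near_point :: "bool \<times> int \<Rightarrow> int" where
  "near_point = (\<lambda>(e, j). (j + (if e then a else 0)) mod m)"

text \<open>The signed distance stays within \<open>N\<close> along the word, too little to reach
  the other marked point in either direction.\<close>

lemma word_act_near_point:
  assumes "w \<in> words" "\<bar>j\<bar> + int (length w) \<le> N" "N < a" "a + N < m"
  shows "word_act m a w (near_point (e, j)) = near_point (foldr limit_act w (e, j))"
  using assms
proof (induction w)
  case (Cons d w)
  obtain e' t where et: "foldr limit_act w (e, j) = (e', t)" by fastforce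
  have "t = j + sum_list w" using snd_limit_act[of w e j] et by simp
  then have t: "\<bar>t\<bar> \<le> N" using abs_sum_list_le_length[of w] Cons.prems by auto
  have IH: "word_act m a w (near_point (e, j)) = near_point (e', t)" using Cons et by simp
  have range: "0 \<le> near_point (e', t)" "near_point (e', t) < m"
    using a_pos a_less by (auto simp: near_point_def)
  have "letter_act m a d (near_point (e', t)) = near_point (limit_act d (e', t))"
  proof (cases "d = 0")
    case False
    then show ?thesis using range by (simp add: letter_act_def limit_act_def)
        (simp add: near_point_def mod_simps algebra_simps)
  next
    case d: True
    show ?thesis
    proof (cases "t = 0")
      case True
      then show ?thesis using d a_pos a_less
        by (auto simp: letter_act_zero limit_act_def near_point_def)
    next
      case False
      \<comment> \<open>A negative offset from \<open>0\<close> wraps around to a point still above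
        \<open>a\<close>, since \<open>a + N < m\<close>. Hence only offset \<open>0\<close> meets a
        marked point.\<close>
      have "t mod m = (if t < 0 then t + m else t)"
        using t a_pos a_less Cons.prems mod_pos_pos_trivial[of t m] mod_pos_pos_trivial[of "t + m" m]
        by simp
      moreover have "(t + a) mod m = t + a" using t a_pos Cons.prems by (intro mod_pos_pos_trivial) auto
      ultimately have "near_point (e', t) \<noteq> 0" "near_point (e', t) \<noteq> a"
        using t False a_pos Cons.prems by (auto simp: near_point_def split: if_splits)
      then show ?thesis using d False by (simp add: letter_act_zero limit_act_def)
    qed
  qed
  then show ?case using IH et by (simp add: word_act_Cons)
qed simp

lemma word_act_far:
  assumes "w \<in> words" "int (length w) \<le> n" "p \<in> {0..<m}"
    and far: "\<And>t. \<bar>t\<bar> \<le> n \<Longrightarrow> (p + t) mod m \<notin> {0, a}"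
  shows "word_act m a w p = (p + sum_list w) mod m"
  using assms(1,2)
proof (induction w)
  case (Cons d w)
  have IH: "word_act m a w p = (p + sum_list w) mod m" using Cons by simp
  have "(p + sum_list w) mod m \<notin> {0, a}"
    using far abs_sum_list_le_length[of w] Cons.prems by auto
  then show ?case using IH a_pos a_less
    by (auto simp: word_act_Cons letter_act_def mod_simps algebra_simps)
qed (use assms in simp)

text \<open>The right-hand side mentions neither \<open>m\<close> nor \<open>a\<close>, so a short
  word is trivial on one cycle with distant marked points iff it is trivial on all of them. Points
  within \<open>n\<close> of a marked point follow \<open>limit_act\<close>; all others are
  translated.\<close>

lemma word_act_eq_id_iff:
  assumes w: "w \<in> words" "int (length w) \<le> n" and n: "2 * n < a" "2 * a < m"
  shows "word_act m a w = id \<longleftrightarrow>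
    sum_list w = 0 \<and> (\<forall>e j. \<bar>j\<bar> \<le> n \<longrightarrow> fst (foldr limit_act w (e, j)) = e)"
proof
  assume triv: "word_act m a w = id"
  have "sum_list w = 0 \<and> fst (foldr limit_act w (e, j)) = e" if j: "\<bar>j\<bar> \<le> n" for e j
  proof -
    obtain e' where e': "foldr limit_act w (e, j) = (e', j + sum_list w)"
      using snd_limit_act[of w e j] by (metis prod.collapse)
    have "near_point (e, j) = near_point (e', j + sum_list w)"
      using word_act_near_point[of w j "2 * n" e] w n j triv e' by simp
    \<comment> \<open>The difference is \<open>sum_list w\<close> plus \<open>0\<close>,
      \<open>a\<close> or \<open>- a\<close>: less than \<open>m\<close> in absolute value, and
      nonzero if \<open>e\<close> and \<open>e'\<close> differ, because \<open>sum_list w\<close> is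
      at most \<open>n < a\<close> in absolute value.\<close>
    then have "m dvd (j + sum_list w + (if e' then a else 0)) - (j + (if e then a else 0))"
      unfolding near_point_def case_prod_conv by (metis mod_eq_dvd_iff)
    then have dvd: "m dvd sum_list w + ((if e' then a else 0) - (if e then a else 0))"
      by (simp add: algebra_simps)
    have "\<bar>sum_list w\<bar> \<le> n" using abs_sum_list_le_length[OF w(1)] w(2) by simp
    then have "\<bar>sum_list w + ((if e' then a else 0) - (if e then a else 0))\<bar> < \<bar>m\<bar>"
      and ne: "e \<noteq> e' \<Longrightarrow> sum_list w + ((if e' then a else 0) - (if e then a else 0)) \<noteq> 0"
      using n a_pos by (cases e; cases e'; simp)+
    then have "sum_list w + ((if e' then a else 0) - (if e then a else 0)) = 0"
      using dvd dvd_imp_le_int linorder_not_less by blast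
    then show ?thesis using ne e' by (cases "e = e'") auto
  qed
  note * = this
  have "\<bar>0\<bar> \<le> n" using w by simp
  then show "sum_list w = 0 \<and> (\<forall>e j. \<bar>j\<bar> \<le> n \<longrightarrow> fst (foldr limit_act w (e, j)) = e)"
    using * by blast
next
  assume triv: "sum_list w = 0 \<and> (\<forall>e j. \<bar>j\<bar> \<le> n \<longrightarrow> fst (foldr limit_act w (e, j)) = e)"
  have near: "word_act m a w p = p" if "\<bar>j\<bar> \<le> n" "p = near_point (e, j)" for p e j
  proof -
    have "foldr limit_act w (e, j) = (e, j)"
      using triv that snd_limit_act[of w e j] by (simp add: prod_eq_iff)
    then show ?thesis using word_act_near_point[of w j "2 * n" e] w n that by simp
  qed
  show "word_act m a w = id"
  proof
    fix p show "word_act m a w p = id p"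
    proof (cases "p \<in> {0..<m}")
      case False then show ?thesis by (simp add: word_act_outside)
    next
      case p: True
      show ?thesis
      proof (cases "\<exists>t. \<bar>t\<bar> \<le> n \<and> (p + t) mod m \<in> {0, a}")
        case True
        then obtain t where t: "\<bar>t\<bar> \<le> n" "(p + t) mod m \<in> {0, a}" by (elim exE conjE)
        have "((p + t) mod m - t) mod m = p" using p by (simp add: mod_diff_left_eq)
        moreover have "(p + t) mod m - t = - t + (if (p + t) mod m = a then a else 0)"
          using t(2) by auto
        ultimately have "p = near_point ((p + t) mod m = a, - t)" by (simp only: near_point_def case_prod_conv)
        then have "word_act m a w p = p" by (rule near[rotated]) (use t in simp)
        then show ?thesis by simp
      next
        case False
        have "(p + t) mod m \<notin> {0, a}" if "\<bar>t\<bar> \<le> n" for t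
          by (rule notI, rule notE[OF False], intro exI conjI, rule that)
        then have "word_act m a w p = (p + sum_list w) mod m" by (rule word_act_far[OF w p])
        then show ?thesis using p triv by simp
      qed
    qed
  qed
qed

end

section \<open>The group acting on a sequence of marked cycles\<close>

text \<open>Coprimality yields all transpositions of a cycle, \<open>2 * a k < m k\<close> makes
  \<open>0\<close>, \<open>a k\<close> and \<open>2 * a k\<close> distinct points, and
  nondivisibility confines the action of \<open>comm_word k\<close> to cycle
  \<open>k\<close>.\<close>

locale marked_cycles =
  fixes m a :: "nat \<Rightarrow> int"
  assumes a_pos: "0 < a k" and a_less: "2 * a k < m k" and coprime: "coprime (a k) (m k)"
    and not_dvd: "i \<noteq> k \<Longrightarrow> \<not> m i dvd a k"
      "i \<noteq> k \<Longrightarrow> \<not> m i dvd a k - a i" "i \<noteq> k \<Longrightarrow> \<not> m i dvd a k + a i"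
begin

sublocale cycle: marked_cycle "m k" "a k" for k
  using a_pos[of k] a_less[of k] by unfold_locales auto

definition points :: "nat \<Rightarrow> (nat \<times> int) set" where
  "points k = {k} \<times> {0..<m k}"

lemma finite_points: "finite (points k)" and card_points: "card (points k) = nat (m k)"
  by (auto simp: points_def)

definition perm :: "int list \<Rightarrow> nat \<times> int \<Rightarrow> nat \<times> int" where
  "perm w = (\<lambda>(k, p). (k, word_act (m k) (a k) w p))"

lemma perm_append: "perm (u @ v) = perm u \<circ> perm v"
  by (auto simp: perm_def word_act_append)

lemma perm_Nil [simp]: "perm [] = id"
  by (auto simp: perm_def)

lemma perm_eq_iff: "perm u = perm v \<longleftrightarrow> (\<forall>k. word_act (m k) (a k) u = word_act (m k) (a k) v)"
  by (auto simp: perm_def fun_eq_iff)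

lemma perm_inv: "perm (word_inv w) \<circ> perm w = id" "perm w \<circ> perm (word_inv w) = id"
  unfolding perm_append[symmetric] perm_Nil[symmetric] perm_eq_iff
  by (simp_all add: word_act_append cycle.word_act_inv cycle.word_act_inv')

lemma inv_perm: "Hilbert_Choice.inv (perm w) = perm (word_inv w)"
  by (rule inv_unique_comp) (rule perm_inv)+

lemma bij_perm: "bij (perm w)"
  using perm_inv o_bij by blast

lemma perm_points: "p \<in> points k \<Longrightarrow> perm w p \<in> points k"
  using cycle.word_act_range by (auto simp: points_def perm_def)

lemma perm_moves: "perm w p \<noteq> p \<Longrightarrow> p \<in> points (fst p)"
  using cycle.word_act_outside[of "snd p" "fst p" w]
  by (cases "snd p \<in> {0..<m (fst p)}") (auto simp: points_def perm_def split_beta mem_Times_iff)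

lemma permutation_group_perms: "permutation_group (perm ` words)"
proof -
  have "\<exists>u\<in>words. id = perm u" by (rule bexI[of _ "[]"]) auto
  then show ?thesis
    unfolding permutation_group_def
    by (auto simp: bij_perm inv_perm perm_append[symmetric])
qed

lemma ex_perm_transposition:
  assumes "i \<in> points k" "j \<in> points k"
  shows "\<exists>w\<in>words. \<forall>p\<in>points k. perm w p = transpose i j p"
proof -
  obtain i' j' where ij: "i = (k, i')" "j = (k, j')" "i' \<in> {0..<m k}" "j' \<in> {0..<m k}"
    using assms by (auto simp: points_def)
  then obtain w where "w \<in> words" "word_act (m k) (a k) w = transpose i' j'"
    using cycle.ex_word_transposition coprime by blast
  then show ?thesis using ij by (intro bexI[of _ w]) (auto simp: perm_def points_def transpose_def)
qed

text \<open>\<open>u\<close> acts as a product of two involutions, the transposition and its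
  conjugate by a translation, so its square is their commutator.\<close>

definition comm_word :: "nat \<Rightarrow> int list" where
  "comm_word k = (let v = cycle.shift_word (a k); u = [0] @ v @ [0] @ word_inv v in u @ u)"

lemma comm_word [simp]: "comm_word k \<in> words" "int (length (comm_word k)) = 4 * a k + 4"
  using a_pos[of k] by (simp_all add: comm_word_def Let_def)

text \<open>On every other cycle the two transpositions are disjoint, hence their commutator is trivial;
  on cycle number \<open>k\<close> they share the point \<open>a k\<close>.\<close>

lemma perm_comm_word: "perm (comm_word k) = three_cycle (k, 0) (k, 2 * a k) (k, a k)"
proof
  fix ip :: "nat \<times> int"
  obtain i p where ip: "ip = (i, p)" by fastforce
  let ?v = "cycle.shift_word (a k)"
  define b where "b = a k mod m i"
  define c where "c = (a i + a k) mod m i"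
  have pos: "0 < a i" "0 < m i" using a_pos[of i] a_less[of i] by auto
  have "word_act (m i) (a i) ([0] @ ?v @ [0] @ word_inv ?v) = transpose 0 (a i) \<circ> transpose b c"
    using cycle.word_act_conj_zero[of i ?v] pos a_less[of i]
    by (subst word_act_append) (simp add: word_act_Cons cycle.letter_act_zero b_def c_def cycle.word_act_shift)
  then have act: "word_act (m i) (a i) (comm_word k) =
      (transpose 0 (a i) \<circ> transpose b c) \<circ> (transpose 0 (a i) \<circ> transpose b c)"
    by (simp only: comm_word_def Let_def word_act_append)
  show "perm (comm_word k) ip = three_cycle (k, 0) (k, 2 * a k) (k, a k) ip"
  proof (cases "i = k")
    case True
    have "b = a k" "c = 2 * a k" using True pos a_less[of k] by (auto simp: b_def c_def)
    then have "word_act (m i) (a i) (comm_word k) = three_cycle 0 (2 * a k) (a k)"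
      unfolding act using True a_pos[of k] by (auto simp: three_cycle_def transpose_def fun_eq_iff)
    then show ?thesis using True ip by (auto simp: perm_def three_cycle_def transpose_def)
  next
    case False
    have ai: "a i mod m i = a i" using pos a_less[of i] by simp
    \<comment> \<open>The first and last inequality say that \<open>m i\<close> does not divide
      \<open>a k\<close>; the middle two are the other nondivisibility conditions.\<close>
    have "b \<noteq> 0" "b \<noteq> a i" "c \<noteq> 0" "c \<noteq> a i"
      using not_dvd[OF False] mod_eq_dvd_iff[of "a k" "m i" "a i"] mod_eq_dvd_iff[of "a i + a k" "m i" "a i"] ai
      by (auto simp: b_def c_def dvd_eq_mod_eq_0 add.commute)
    then have "word_act (m i) (a i) (comm_word k) = id"
      unfolding act using pos by (auto simp: transpose_def fun_eq_iff)
    then show ?thesis using False ip by (auto simp: perm_def three_cycle_def)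
  qed
qed

text \<open>Starting from the cycle of \<open>comm_word k\<close>, three conjugations put
  \<open>i\<close>, \<open>j\<close> and \<open>l\<close> in place one after another. A conjugating
  element matters only through its values on \<open>points k\<close>.\<close>

lemma three_cycles_in_perms:
  assumes "i \<in> points k" "j \<in> points k" "l \<in> points k" "distinct [i, j, l]"
  shows "three_cycle i j l \<in> perm ` words"
proof -
  have conj: "three_cycle (transpose p q x) (transpose p q y) (transpose p q z) \<in> perm ` words"
    if C: "three_cycle x y z \<in> perm ` words" "x \<in> points k" "y \<in> points k" "z \<in> points k"
      and pq: "p \<in> points k" "q \<in> points k" for p q x y z
  proof -
    obtain w where w: "w \<in> words" "\<And>r. r \<in> points k \<Longrightarrow> perm w r = transpose p q r"
      using ex_perm_transposition[OF pq] by metis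
    obtain u where u: "u \<in> words" "three_cycle x y z = perm u" using C by auto
    have "three_cycle (perm w x) (perm w y) (perm w z) = perm (w @ u @ word_inv w)"
      using conj_three_cycle[OF bij_is_inj[OF bij_perm] perm_inv(2), of w x y z] u
      by (simp add: perm_append comp_assoc)
    then show ?thesis using w u C by auto
  qed
  have tr: "transpose p q r \<in> points k" if "p \<in> points k" "q \<in> points k" "r \<in> points k" for p q r
    using that by (auto simp: transpose_def)
  let ?x = "(k, 0)" and ?y = "(k, 2 * a k)" and ?z = "(k, a k)"
  have xyz: "?x \<in> points k" "?y \<in> points k" "?z \<in> points k" "distinct [?x, ?y, ?z]"
    using a_pos[of k] a_less[of k] by (auto simp: points_def)
  define y z where "y = transpose ?x i ?y" and "z = transpose ?x i ?z"
  have "three_cycle ?x ?y ?z \<in> perm ` words" using perm_comm_word[of k] comm_word(1) by (metis imageI)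
  from conj[OF this xyz(1-3) xyz(1) assms(1)] have 1: "three_cycle i y z \<in> perm ` words"
    by (simp add: y_def z_def)
  have yz: "y \<in> points k" "z \<in> points k" using tr xyz assms by (auto simp: y_def z_def)
  have d1: "distinct [i, y, z]"
    using xyz(4) unfolding y_def z_def by (auto simp: transpose_def)
  define z' where "z' = transpose y j z"
  have 2: "three_cycle i j z' \<in> perm ` words"
    using conj[OF 1 assms(1) yz yz(1) assms(2)] d1 assms(4) by (simp add: z'_def)
  have d2: "distinct [i, j, z']" "z' \<in> points k"
    using d1 assms yz tr unfolding z'_def by (auto simp: transpose_def)
  show ?thesis
    using conj[OF 2 assms(1,2) d2(2) d2(2) assms(3)] d2 assms(4) by simp
qed

end


section \<open>The abstract group, its word balls and depths\<close>

locale marked_cycles_group = marked_cycles m a + group G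
  for m a :: "nat \<Rightarrow> int" and G :: "'g monoid" (structure) +
  fixes \<phi> :: "'g \<Rightarrow> nat \<times> int \<Rightarrow> nat \<times> int"
  assumes bij: "bij_betw \<phi> (carrier G) (perm ` words)" and \<phi>_one: "\<phi> \<one> = id"
    and \<phi>_mult: "\<And>g h. g \<in> carrier G \<Longrightarrow> h \<in> carrier G \<Longrightarrow> \<phi> (g \<otimes> h) = \<phi> g \<circ> \<phi> h"
begin

definition elt :: "int list \<Rightarrow> 'g" where
  "elt w = inv_into (carrier G) \<phi> (perm w)"

definition gens :: "'g set" where
  "gens = {elt [0], elt [1]}"

lemma elt [simp]: assumes "w \<in> words" shows "elt w \<in> carrier G" "\<phi> (elt w) = perm w"
  using assms bij unfolding elt_def bij_betw_def by (metis imageI inv_into_into, metis f_inv_into_f imageI)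

lemma \<phi>_inj: "g \<in> carrier G \<Longrightarrow> h \<in> carrier G \<Longrightarrow> \<phi> g = \<phi> h \<Longrightarrow> g = h"
  using bij by (auto simp: bij_betw_def inj_on_def)

lemma carrier_eq: "carrier G = elt ` words"
proof
  show "carrier G \<subseteq> elt ` words"
  proof
    fix g assume g: "g \<in> carrier G"
    then obtain w where "w \<in> words" "\<phi> g = perm w" using bij by (auto simp: bij_betw_def)
    then have "g = elt w" using g by (intro \<phi>_inj) auto
    then show "g \<in> elt ` words" using \<open>w \<in> words\<close> by blast
  qed
qed auto

lemma elt_Nil: "elt [] = \<one>"
  by (rule \<phi>_inj) (auto simp: \<phi>_one)

lemma elt_append: "u \<in> words \<Longrightarrow> v \<in> words \<Longrightarrow> elt (u @ v) = elt u \<otimes> elt v"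
  by (rule \<phi>_inj) (auto simp: \<phi>_mult perm_append)

lemma elt_inv: "w \<in> words \<Longrightarrow> elt (word_inv w) = inv (elt w)"
  by (rule inv_equality[symmetric]) (auto simp: elt_append[symmetric] elt_Nil[symmetric] perm_append perm_inv
      intro!: \<phi>_inj)

lemma \<phi>_inv: "g \<in> carrier G \<Longrightarrow> \<phi> (inv g) = Hilbert_Choice.inv (\<phi> g)"
  by (auto simp: carrier_eq elt_inv[symmetric] inv_perm)

lemma elt_eq_one_iff:
  assumes "w \<in> words"
  shows "elt w = \<one> \<longleftrightarrow> (\<forall>k. word_act (m k) (a k) w = id)"
proof -
  have "elt w = \<one> \<longleftrightarrow> perm w = perm []"
    using \<phi>_inj[of "elt w" \<one>] \<phi>_one elt[OF assms] by (metis one_closed perm_Nil)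
  then show ?thesis by (simp add: perm_eq_iff del: perm_Nil)
qed

lemma letters_eq: "gens \<union> (\<lambda>g. inv g) ` gens = (\<lambda>d. elt [d]) ` {-1, 0, 1}"
proof -
  have "inv (elt [1]) = elt [-1]" using elt_inv[of "[1]"] by (simp add: word_inv_def)
  moreover have "inv (elt [0]) = elt [0]" using elt_inv[of "[0]"] by (simp add: word_inv_def)
  ultimately show ?thesis by (auto simp: gens_def)
qed

lemma gens_subset: "gens \<subseteq> carrier G"
  by (auto simp: gens_def)

lemma elt_foldr: "w \<in> words \<Longrightarrow> elt w = foldr (\<otimes>) (map (\<lambda>d. elt [d]) w) \<one>"
proof (induction w)
  case (Cons d w)
  then have "elt (d # w) = elt [d] \<otimes> elt w" using elt_append[of "[d]" w] by simp
  then show ?case using Cons by simp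
qed (simp add: elt_Nil)

lemma word_ball_eq: "word_ball G gens n = elt ` {w \<in> words. length w \<le> n}"
proof (intro equalityI subsetI)
  fix g assume "g \<in> word_ball G gens n"
  then obtain ws where ws: "g = foldr (\<otimes>) ws \<one>" "length ws \<le> n"
    "set ws \<subseteq> (\<lambda>d. elt [d]) ` {-1, 0, 1}"
    by (auto simp only: word_ball_def letters_eq)
  then have "ws \<in> lists ((\<lambda>d. elt [d]) ` {-1, 0, 1})" by (auto simp: in_lists_conv_set)
  then obtain w where w: "w \<in> words" "ws = map (\<lambda>d. elt [d]) w"
    unfolding lists_image words_def by blast
  then show "g \<in> elt ` {w \<in> words. length w \<le> n}" using ws elt_foldr[OF w(1)]
    by (intro image_eqI[of _ _ w]) simp_all
next
  fix g assume "g \<in> elt ` {w \<in> words. length w \<le> n}"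
  then obtain w where w: "w \<in> words" "length w \<le> n" "g = elt w" by auto
  have "set (map (\<lambda>d. elt [d]) w) \<subseteq> (\<lambda>d. elt [d]) ` {-1, 0, 1}"
    using w by (auto simp: words_def in_lists_conv_set)
  then show "g \<in> word_ball G gens n"
    unfolding word_ball_def letters_eq using w elt_foldr[of w]
    by (intro CollectI exI[of _ "map (\<lambda>d. elt [d]) w"]) simp
qed

lemma generate_gens: "generate G gens = carrier G"
proof
  show "generate G gens \<subseteq> carrier G" using generate_incl[OF gens_subset] .
  have "elt w \<in> generate G gens" if "w \<in> words" for w
    using that
  proof (induction w)
    case Nil then show ?case using generate.one by (simp add: elt_Nil)
  next
    case (Cons d w)
    then have "elt [d] \<in> gens \<union> (\<lambda>g. inv g) ` gens" unfolding letters_eq by auto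
    then have "elt [d] \<in> generate G gens" by (auto intro: generate.incl generate.inv)
    then show ?case using Cons elt_append[of "[d]" w] by (auto intro: generate.eng)
  qed
  then show "carrier G \<subseteq> generate G gens" unfolding carrier_eq by blast
qed

text \<open>The stabilizer of a moved point of cycle \<open>k\<close> serves, as the orbit of that
  point stays in the cycle.\<close>

lemma separating_subgroup:
  assumes "w \<in> words" "word_act (m k) (a k) w \<noteq> id"
  obtains H where "finite_index_subgroup H G" "elt w \<notin> H" "card (rcosets H) \<le> nat (m k)"
proof -
  obtain p where p: "word_act (m k) (a k) w p \<noteq> p" using assms(2) by (metis eq_id_iff)
  then have moves: "perm w (k, p) \<noteq> (k, p)" by (simp add: perm_def)
  then have kp: "(k, p) \<in> points k" using perm_moves by fastforce
  have X: "\<phi> g (k, p) \<in> points k" if "g \<in> carrier G" for g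
    using that kp perm_points by (auto simp: carrier_eq)
  show ?thesis
    using that[of "{g \<in> carrier G. \<phi> g (k, p) = (k, p)}"] moves assms(1)
      stabilizer_finite_index[where \<phi> = \<phi> and p = "(k, p)", OF \<phi>_mult \<phi>_one finite_points X]
    by (simp add: card_points)
qed

lemma residually_finite: "residually_finite G"
  unfolding residually_finite_def
proof (intro conjI ballI impI is_group)
  fix g assume g: "g \<in> carrier G" "g \<noteq> \<one>"
  then obtain w where w: "w \<in> words" "g = elt w" by (auto simp: carrier_eq)
  then obtain k where "word_act (m k) (a k) w \<noteq> id" using g(2) elt_eq_one_iff[OF w(1)] by metis
  then obtain H where "finite_index_subgroup H G" "elt w \<notin> H"
    using separating_subgroup[OF w(1)] by metis
  then show "\<exists>H. finite_index_subgroup H G \<and> g \<notin> H" using w by blast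
qed

lemma depth_le:
  assumes "w \<in> words" "word_act (m k) (a k) w \<noteq> id"
  shows "depth G (elt w) \<le> nat (m k)"
proof -
  obtain H where H: "finite_index_subgroup H G" "elt w \<notin> H" "card (rcosets H) \<le> nat (m k)"
    using separating_subgroup[OF assms] .
  then have "depth G (elt w) \<le> card (rcosets H)"
    unfolding depth_def by (intro Least_le) blast
  then show ?thesis using H by simp
qed

text \<open>\<open>three_cycles_mem_if_small_index\<close> is applied to the image of
  \<open>H\<close> under \<open>\<phi>\<close>, with \<open>points k\<close> as the finite
  set.\<close>

lemma comm_word_in_small_index:
  assumes H: "finite_index_subgroup H G" and small: "Suc (card (rcosets H)) < nat (m k)"
  shows "elt (comm_word k) \<in> H"
proof -
  have sub: "subgroup H G" and fin: "finite (rcosets H)" using H by (auto simp: finite_index_subgroup_def)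
  have HG: "H \<subseteq> carrier G" using sub subgroup.subset by blast
  have in_image: "g \<in> H" if "g \<in> carrier G" "\<phi> g \<in> \<phi> ` H" for g
    using that \<phi>_inj HG by (metis imageE subsetD)
  have "permutation_group (\<phi> ` H)"
    unfolding permutation_group_def
  proof (intro conjI ballI)
    show "id \<in> \<phi> ` H" using subgroup.one_closed[OF sub] \<phi>_one by (metis imageI)
    fix g assume "g \<in> \<phi> ` H"
    then obtain h where h: "h \<in> H" "g = \<phi> h" by blast
    then show "bij g" using HG bij_perm by (auto simp: carrier_eq)
    show "Hilbert_Choice.inv g \<in> \<phi> ` H"
      using h HG \<phi>_inv[of h] subgroup.m_inv_closed[OF sub] by (metis imageI subsetD)
    fix g' assume "g' \<in> \<phi> ` H"
    then obtain h' where h': "h' \<in> H" "g' = \<phi> h'" by blast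
    then show "g \<circ> g' \<in> \<phi> ` H"
      using h HG \<phi>_mult[of h h'] subgroup.m_closed[OF sub] by (metis imageI subsetD)
  qed
  moreover have "Suc (card F) < card (points k)"
    if F: "F \<subseteq> perm ` words" "\<And>f g. f \<in> F \<Longrightarrow> g \<in> F \<Longrightarrow> f \<noteq> g \<Longrightarrow> f \<circ> Hilbert_Choice.inv g \<notin> \<phi> ` H" for F
  proof -
    \<comment> \<open>The permutations in \<open>F\<close> are lifted to group elements, which can
      be counted against the cosets of \<open>H\<close>.\<close>
    obtain E where E: "E \<subseteq> carrier G" "F = \<phi> ` E" "inj_on \<phi> E"
      using F(1) bij subset_imageE by (metis bij_betw_def inj_on_subset)
    have "card E \<le> card (rcosets H)"
    proof (rule card_le_card_rcosets[OF sub fin E(1)])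
      fix x y assume xy: "x \<in> E" "y \<in> E" "x \<noteq> y"
      then have G: "x \<in> carrier G" "y \<in> carrier G" using E by auto
      have "\<phi> x \<circ> Hilbert_Choice.inv (\<phi> y) \<notin> \<phi> ` H"
        using F(2)[of "\<phi> x" "\<phi> y"] xy E by (auto simp: inj_on_def)
      then have "\<phi> (x \<otimes> inv y) \<notin> \<phi> ` H" using G by (simp add: \<phi>_mult \<phi>_inv)
      then show "x \<otimes> inv y \<notin> H" by blast
    qed
    then show ?thesis using small E by (simp add: card_points card_image)
  qed
  moreover have "\<exists>g\<in>perm ` words. \<forall>p\<in>points k. g p = transpose i j p"
    if "i \<in> points k" "j \<in> points k" for i j
    using ex_perm_transposition[OF that] by blast
  moreover have "(k, 0) \<in> points k" "(k, 2 * a k) \<in> points k" "(k, a k) \<in> points k"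
    "distinct [(k, 0), (k, 2 * a k), (k, a k)]"
    using a_pos[of k] a_less[of k] by (auto simp: points_def)
  ultimately have "three_cycle (k, 0) (k, 2 * a k) (k, a k) \<in> \<phi> ` H"
    by (intro three_cycles_mem_if_small_index[OF permutation_group_perms _ finite_points
      three_cycles_in_perms]) blast+
  then show ?thesis using in_image[of "elt (comm_word k)"] by (simp add: perm_comm_word)
qed

lemma comm_word_nontrivial: "word_act (m k) (a k) (comm_word k) \<noteq> id"
proof
  assume "word_act (m k) (a k) (comm_word k) = id"
  then have "perm (comm_word k) (k, 0) = (k, 0)" by (simp add: perm_def)
  then show False using a_pos[of k] by (simp add: perm_comm_word three_cycle_apply)
qed

text \<open>A separating subgroup exists, so the \<open>LEAST\<close> in \<open>depth\<close> is
  attained, and a subgroup attaining it cannot have index below \<open>m k - 1\<close>.\<close>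

lemma depth_comm_word: "nat (m k) \<le> Suc (depth G (elt (comm_word k)))"
proof -
  obtain H where "finite_index_subgroup H G" "elt (comm_word k) \<notin> H"
    using separating_subgroup[OF comm_word(1) comm_word_nontrivial] .
  then have "\<exists>d H. finite_index_subgroup H G \<and> elt (comm_word k) \<notin> H \<and> d = card (rcosets H)" by blast
  then have "\<exists>H. finite_index_subgroup H G \<and> elt (comm_word k) \<notin> H \<and>
      depth G (elt (comm_word k)) = card (rcosets H)"
    unfolding depth_def by (rule LeastI_ex)
  then show ?thesis using comm_word_in_small_index by (metis linorder_not_less)
qed

lemma finite_word_ball: "finite (word_ball G gens n)"
proof -
  have "{w \<in> words. length w \<le> n} = {w. set w \<subseteq> {-1, 0, 1} \<and> length w \<le> n}"
    by (auto simp: words_def in_lists_conv_set)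
  then show ?thesis unfolding word_ball_eq by (auto intro: finite_lists_length_le)
qed

lemma divisibility_function_ge:
  assumes "4 * a k + 4 \<le> int n"
  shows "nat (m k) \<le> Suc (divisibility_function G gens n)"
proof -
  have "elt (comm_word k) \<noteq> \<one>"
    using elt_eq_one_iff[OF comm_word(1)[of k]] comm_word_nontrivial[of k] by metis
  moreover have "elt (comm_word k) \<in> word_ball G gens n"
  proof -
    have "length (comm_word k) \<le> n" using comm_word(2)[of k] assms by linarith
    then show ?thesis unfolding word_ball_eq by (intro imageI) simp
  qed
  ultimately have "depth G (elt (comm_word k)) \<le> divisibility_function G gens n"
    unfolding divisibility_function_def using finite_word_ball by (intro Max_ge) auto
  then show ?thesis using depth_comm_word[of k] by simp
qed

text \<open>From cycle \<open>k\<close> on, triviality of a word of length at most \<open>n\<close>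
  is one and the same condition, so an element acting nontrivially on a later cycle does so on cycle
  \<open>k\<close>.\<close>

lemma divisibility_function_le:
  assumes n: "1 \<le> n" and far: "\<And>i. k \<le> i \<Longrightarrow> 2 * int n < a i"
    and bound: "\<And>i. i \<le> k \<Longrightarrow> nat (m i) \<le> B"
  shows "divisibility_function G gens n \<le> B"
proof -
  \<comment> \<open>The transposition generator makes the set under \<open>Max\<close>
    nonempty.\<close>
  have "word_act (m 0) (a 0) [0] \<noteq> id"
    using a_pos[of 0] by (auto simp: word_act_Cons cycle.letter_act_zero transpose_eq_id_iff)
  then have "elt [0] \<noteq> \<one>" using elt_eq_one_iff[of "[0]"] by (metis words_simps(1,3) insertI1 insertI2)
  then have "elt [0] \<in> word_ball G gens n - {\<one>}" using n by (auto simp: word_ball_eq)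
  moreover have "depth G g \<le> B" if g: "g \<in> word_ball G gens n - {\<one>}" for g
  proof -
    obtain w where w: "w \<in> words" "length w \<le> n" "g = elt w" using g by (auto simp: word_ball_eq)
    obtain i where i: "word_act (m i) (a i) w \<noteq> id"
      using g w(3) elt_eq_one_iff[OF w(1)] by (metis DiffD2 singletonI)
    have "\<exists>j\<le>k. word_act (m j) (a j) w \<noteq> id"
    proof (cases "i \<le> k")
      case False
      have "word_act (m j) (a j) w = id \<longleftrightarrow> sum_list w = 0 \<and>
          (\<forall>e t. \<bar>t\<bar> \<le> int n \<longrightarrow> fst (foldr limit_act w (e, t)) = e)" if "k \<le> j" for j
        by (rule cycle.word_act_eq_id_iff) (use w far[OF that] a_less in auto)
      from this[of k] this[of i] show ?thesis using i False by auto
    qed (use i in blast)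
    then show ?thesis using depth_le[OF w(1)] bound w(3) by (meson order_trans)
  qed
  ultimately show ?thesis
    unfolding divisibility_function_def using finite_word_ball by (subst Max_le_iff) auto
qed

end

section \<open>Choice of the parameters\<close>

text \<open>Parity excludes divisibility of \<open>a k\<close> itself. Sums and differences are too
  small to be multiples of \<open>m i\<close> if \<open>k < i\<close>, and are handled modulo a
  smaller power of two if \<open>i < k\<close>.\<close>

lemma marked_cycles_powers:
  fixes e :: "nat \<Rightarrow> nat"
  assumes i0: "2 \<le> i0" and e: "\<And>k. k + i0 + 2 \<le> e k"
  shows "marked_cycles (\<lambda>k. 2 ^ e k) (\<lambda>k. 2 ^ (k + i0) + 1)"
proof
  have four: "(4::int) \<le> 2 ^ (k + i0)" for k
    using power_increasing[of 2 "k + i0" "2::int"] i0 by simp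
  have m: "(4::int) * 2 ^ (k + i0) \<le> 2 ^ e k" for k
    using power_increasing[OF e[of k], of "2::int"] by (simp add: power_add)
  have arith: "2 * (x + 1) < y" if "4 \<le> x" "4 * x \<le> y" for x y :: int using that by simp
  have small: "\<not> y dvd u + 1 - (v + 1) \<and> \<not> y dvd u + 1 + (v + 1)"
    if "4 \<le> u" "u < v" "4 * v \<le> y" for u v y :: int
  proof -
    have "\<not> y dvd v - u" "\<not> y dvd u + 1 + (v + 1)"
      by (rule zdvd_not_zless; use that in simp)+
    then show ?thesis using dvd_diff_commute[of y u v] by simp
  qed
  have eqs: "u + 1 - (v + 1) = u - v" "u + 1 + (v + 1) = u + (v + 2)" for u v :: int by simp_all
  have even_m: "even ((2::int) ^ e k)" for k using e[of k] i0 by simp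
  have odd_a: "odd ((2::int) ^ (k + i0) + 1)" for k using i0 by simp
  fix k
  show "(0::int) < 2 ^ (k + i0) + 1" using four[of k] by simp
  show "(2::int) * (2 ^ (k + i0) + 1) < 2 ^ e k" using arith[OF four m] .
  show "Rings.coprime ((2::int) ^ (k + i0) + 1) (2 ^ e k)" using odd_a[of k] by simp
  fix i :: nat
  show "\<not> (2::int) ^ e i dvd 2 ^ (k + i0) + 1" using even_m[of i] odd_a[of k] dvd_trans by blast
  assume "i \<noteq> k"
  then consider "k < i" | "i < k" by linarith
  then have "\<not> (2::int) ^ e i dvd 2 ^ (k + i0) + 1 - (2 ^ (i + i0) + 1) \<and>
      \<not> (2::int) ^ e i dvd 2 ^ (k + i0) + 1 + (2 ^ (i + i0) + 1)"
  proof cases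
    case 1
    then have "(2::int) ^ (k + i0) < 2 ^ (i + i0)" by (intro power_strict_increasing) auto
    then show ?thesis using small[OF four _ m] by blast
  next
    case 2
    \<comment> \<open>Modulo \<open>d\<close> the term \<open>2 ^ (k + i0)\<close> vanishes. What
      remains, up to sign, is \<open>2 ^ (i + i0)\<close> or \<open>2 ^ (i + i0) + 2\<close>, both
      positive and below \<open>d\<close>.\<close>
    define d :: int where "d = 2 ^ Suc (i + i0)"
    have dm: "d dvd 2 ^ e i" unfolding d_def using e[of i] by (intro le_imp_power_dvd) simp
    have dk: "d dvd 2 ^ (k + i0)" unfolding d_def using 2 by (intro le_imp_power_dvd) simp
    have "\<not> d dvd 2 ^ (i + i0)" "\<not> d dvd 2 ^ (i + i0) + 2"
      using four[of i] zdvd_not_zless[of "2 ^ (i + i0)" d] zdvd_not_zless[of "2 ^ (i + i0) + 2" d]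
      by (auto simp: d_def)
    then have "\<not> d dvd 2 ^ (k + i0) - 2 ^ (i + i0)" "\<not> d dvd 2 ^ (k + i0) + (2 ^ (i + i0) + 2)"
      using dk by (simp_all add: dvd_diff_right_iff dvd_add_right_iff)
    then show ?thesis using dvd_trans[OF dm] unfolding eqs by blast
  qed
  then show "\<not> (2::int) ^ e i dvd 2 ^ (k + i0) + 1 - (2 ^ (i + i0) + 1)"
    "\<not> (2::int) ^ e i dvd 2 ^ (k + i0) + 1 + (2 ^ (i + i0) + 1)" by auto
qed

lemma (in marked_cycles) ex_group:
  "\<exists>(G :: nat monoid) S. residually_finite G \<and> finite S \<and> S \<subseteq> carrier G \<and> generate G S = carrier G \<and>
    (\<forall>k n. 4 * a k + 4 \<le> int n \<longrightarrow> nat (m k) \<le> Suc (divisibility_function G S n)) \<and>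
    (\<forall>k n B. 1 \<le> n \<longrightarrow> (\<forall>i\<ge>k. 2 * int n < a i) \<longrightarrow> (\<forall>i\<le>k. nat (m i) \<le> B) \<longrightarrow>
      divisibility_function G S n \<le> B)"
proof -
  have perms: "id \<in> perm ` words" "\<And>g h. g \<in> perm ` words \<Longrightarrow> h \<in> perm ` words \<Longrightarrow> g \<circ> h \<in> perm ` words"
    using permutation_group_perms unfolding permutation_group_def by blast+
  have inv: "\<exists>h\<in>perm ` words. h \<circ> g = id" if "g \<in> perm ` words" for g
  proof -
    obtain w where "w \<in> words" "g = perm w" using \<open>g \<in> perm ` words\<close> by (rule imageE)
    then show ?thesis by (intro bexI[of _ "perm (word_inv w)"] imageI) (simp_all add: perm_inv)
  qed
  have "countable (perm ` words)" by simp
  from countable_permutation_group_as_nat_group[OF this perms inv]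
  obtain G :: "nat monoid" and \<phi> where G: "group G" "bij_betw \<phi> (carrier G) (perm ` words)"
    "\<phi> \<one>\<^bsub>G\<^esub> = id" "\<forall>g\<in>carrier G. \<forall>h\<in>carrier G. \<phi> (g \<otimes>\<^bsub>G\<^esub> h) = \<phi> g \<circ> \<phi> h"
    by metis
  interpret marked_cycles_group m a G \<phi>
    using G marked_cycles_axioms by (auto simp: marked_cycles_group_def marked_cycles_group_axioms_def)
  have "finite gens" by (simp add: gens_def)
  then show ?thesis
    using residually_finite gens_subset generate_gens divisibility_function_ge divisibility_function_le
    by (intro exI[of _ G] exI[of _ gens]) blast
qed

text \<open>For large powers of two the iterated logarithm is at least \<open>1\<close> and the
  logarithm at least \<open>4 / c\<close>. The factor \<open>4\<close> provides the gap between
  \<open>a\<close> and \<open>m\<close> in \<open>marked_cycles_powers\<close>.\<close>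

lemma superlinear_at_powers_of_two:
  fixes f :: "nat \<Rightarrow> nat"
  assumes "c > 0" "\<epsilon> > 0"
    and f: "\<And>n. n \<ge> 1 \<Longrightarrow> real (f n) \<ge> c * real n * ln (real n) * loglog_factor \<epsilon> n"
  shows "\<exists>i0\<ge>2. \<forall>i\<ge>i0. 4 * 2 ^ i \<le> f (2 ^ i)"
proof -
  \<comment> \<open>The bound \<open>3\<close> exceeds e, so the iterated logarithm is at least
    \<open>1\<close>; the final \<open>+ 2\<close> ensures \<open>2 \<le> i0\<close>.\<close>
  define i0 where "i0 = nat \<lceil>(max 3 (4 / c)) / ln 2\<rceil> + 2"
  have "4 * 2 ^ i \<le> f (2 ^ i)" if "i \<ge> i0" for i
  proof -
    have "(max 3 (4 / c)) / ln 2 \<le> real i" using that unfolding i0_def by linarith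
    then have "max 3 (4 / c) \<le> real i * ln 2" by (simp add: divide_le_eq)
    then have ln: "3 \<le> ln (2 ^ i :: real)" "4 / c \<le> ln (2 ^ i)" by (simp_all add: ln_realpow)
    have "1 \<le> ln (ln (2 ^ i :: real))" using ln(1) exp_le by (subst ln_ge_iff) linarith+
    moreover have "2 < (2::nat) ^ i"
      using power_strict_increasing[of 1 i "2::nat"] that by (simp add: i0_def)
    ultimately have "1 \<le> loglog_factor \<epsilon> (2 ^ i)"
      using assms(2) by (auto simp: loglog_factor_def intro!: ge_one_powr_ge_zero)
    moreover have "4 \<le> c * ln (2 ^ i)" using ln(2) assms(1) by (simp add: divide_le_eq mult.commute)
    ultimately have "4 * 1 \<le> (c * ln (2 ^ i)) * loglog_factor \<epsilon> (2 ^ i)"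
      by (intro mult_mono) auto
    then have "4 * 2 ^ i \<le> (c * ln (2 ^ i)) * loglog_factor \<epsilon> (2 ^ i) * 2 ^ i" by simp
    also have "\<dots> \<le> real (f (2 ^ i))" using f[of "2 ^ i"] by (simp add: mult_ac)
    finally have "real (4 * 2 ^ i) \<le> real (f (2 ^ i))" by simp
    then show ?thesis by (simp only: of_nat_le_iff)
  qed
  then show ?thesis by (intro exI[of _ i0]) (auto simp: i0_def)
qed

theorem theorem3p8:
  fixes f :: "nat \<Rightarrow> nat"
  assumes "\<forall>n\<ge>1. f n \<ge> 1"
    and "mono_on {1..} f"
    and "\<exists>c>0. \<exists>\<epsilon>>0. \<forall>n\<ge>1. real (f n) \<ge> c * real n * ln (real n) * loglog_factor \<epsilon> n"
  shows "\<exists>(G :: nat monoid) S. \<exists>c1>0. \<exists>c2>0.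
           residually_finite G \<and>
           finite S \<and> S \<subseteq> carrier G \<and> generate G S = carrier G \<and>
           (\<forall>n\<ge>1.
              (real n / c1 - c2 > 0 \<longrightarrow>
                 at_real f (real n / c1 - c2) \<le> divisibility_function G S n) \<and>
              divisibility_function G S n \<le> 2 * at_real f (c1 * real n + c2))"
proof -
  have mono: "f x \<le> f y" if "1 \<le> x" "x \<le> y" for x y
    using assms(2) that by (auto simp: mono_on_def)
  obtain i0 where i0: "2 \<le> i0" "\<And>i. i0 \<le> i \<Longrightarrow> 4 * 2 ^ i \<le> f (2 ^ i)"
    using assms(3) superlinear_at_powers_of_two[of _ _ f] by metis
  \<comment> \<open>The exponent is one more than that of the largest power of two not exceeding
    \<open>f (2 ^ (k + i0))\<close>.\<close>
  have "\<exists>e. f (2 ^ (k + i0)) < 2 ^ e \<and> 2 ^ e \<le> 2 * f (2 ^ (k + i0))" for k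
    using ex_power_ivl1[of 2 "f (2 ^ (k + i0))"] assms(1)
    by (metis One_nat_def Suc_leI add.commute mult_le_mono2 numeral_le_iff one_le_numeral one_le_power
        plus_1_eq_Suc power_Suc order_refl semiring_norm(68))
  then obtain e where e: "\<And>k. f (2 ^ (k + i0)) < 2 ^ e k" "\<And>k. 2 ^ e k \<le> 2 * f (2 ^ (k + i0))"
    by metis
  have "k + i0 + 2 \<le> e k" for k
  proof -
    have "(2::nat) ^ (k + i0 + 2) < 2 ^ e k"
      using i0(2)[of "k + i0"] e(1)[of k] by (simp add: power_add)
    then have "k + i0 + 2 < e k" by (rule power_less_imp_less_exp[rotated]) simp
    then show ?thesis by simp
  qed
  then have "marked_cycles (\<lambda>k. 2 ^ e k) (\<lambda>k. 2 ^ (k + i0) + 1)"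
    by (rule marked_cycles_powers[OF i0(1)])
  from marked_cycles.ex_group[OF this] obtain G :: "nat monoid" and S where
    G: "residually_finite G" "finite S" "S \<subseteq> carrier G" "generate G S = carrier G" and
    ge: "\<And>k n. 4 * (2 ^ (k + i0) + 1) + 4 \<le> int n \<Longrightarrow> nat (2 ^ e k) \<le> Suc (divisibility_function G S n)" and
    le: "\<And>k n B. \<lbrakk>1 \<le> n; \<And>i. k \<le> i \<Longrightarrow> 2 * int n < 2 ^ (i + i0) + 1; \<And>i. i \<le> k \<Longrightarrow> nat (2 ^ e i) \<le> B\<rbrakk>
      \<Longrightarrow> divisibility_function G S n \<le> B"
    by metis
  have lower: "at_real f (real n / 8 - 2 ^ i0) \<le> divisibility_function G S n"
    if pos: "real n / 8 - 2 ^ i0 > 0" for n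
  proof -
    have n: "8 * 2 ^ i0 < n"
    proof -
      have "real (8 * 2 ^ i0) < real n" using pos by simp
      then show ?thesis by (simp only: of_nat_less_iff)
    qed
    have "4 \<le> (2::nat) ^ i0" using power_increasing[of 2 i0 "2::nat"] i0(1) by simp
    then have "2 ^ i0 * 4 \<le> n - 8" using n by linarith
    then have q: "2 ^ i0 \<le> (n - 8) div 4" by (simp add: less_eq_div_iff_mult_less_eq)
    then have "1 \<le> (n - 8) div 4" by (rule order_trans[rotated]) simp
    \<comment> \<open>The largest \<open>i\<close> for which the commutator word, of length
      \<open>4 * 2 ^ i + 8\<close>, fits into the ball. Maximality gives
      \<open>n < 8 * 2 ^ i + 8\<close>, whence the constant \<open>8\<close>.\<close>
    then obtain i where i: "2 ^ i \<le> (n - 8) div 4" "(n - 8) div 4 < 2 ^ (i + 1)"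
      using ex_power_ivl1[of 2 "(n - 8) div 4"] by auto
    have "(2::nat) ^ i0 < 2 ^ (i + 1)" using q i(2) by (rule le_less_trans)
    then have "i0 < i + 1" by (rule power_less_imp_less_exp[rotated]) simp
    then obtain k where k: "i = k + i0" using le_Suc_ex[of i0 i] by (auto simp: add.commute)
    have ln: "4 * 2 ^ i + 8 \<le> n" "n < 8 * 2 ^ i + 8"
      using i n by (simp_all add: less_eq_div_iff_mult_less_eq div_less_iff_less_mult)
    have "real n < real (8 * 2 ^ i + 8)" using ln(2) by (simp only: of_nat_less_iff)
    moreover have "(4::real) \<le> 2 ^ i0" using power_increasing[of 2 i0 "2::real"] i0(1) by simp
    ultimately have "real n / 8 - 2 ^ i0 \<le> 2 ^ i" by simp
    then have "nat \<lceil>real n / 8 - 2 ^ i0\<rceil> \<le> 2 ^ i"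
      by (simp add: nat_le_iff ceiling_le_iff)
    \<comment> \<open>Monotonicity of \<open>f\<close> is available from \<open>1\<close>
      on.\<close>
    moreover have "1 \<le> nat \<lceil>real n / 8 - 2 ^ i0\<rceil>" using pos by linarith
    ultimately have "at_real f (real n / 8 - 2 ^ i0) \<le> f (2 ^ i)" unfolding at_real_def by (rule mono[rotated])
    \<comment> \<open>The strictness here absorbs the \<open>Suc\<close> in the next bound.\<close>
    moreover have "f (2 ^ i) < 2 ^ e k" using e(1)[of k] k by simp
    moreover have "nat (2 ^ e k) \<le> Suc (divisibility_function G S n)"
    proof (rule ge)
      have "int (4 * 2 ^ i + 8) \<le> int n" using ln(1) by (simp only: of_nat_le_iff)
      then show "4 * (2 ^ (k + i0) + 1) + 4 \<le> int n" by (simp add: k)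
    qed
    ultimately show ?thesis by (simp add: nat_power_eq)
  qed
  have upper: "divisibility_function G S n \<le> 2 * at_real f (8 * real n + 2 ^ i0)" if n: "n \<ge> 1" for n
  proof -
    obtain j where j: "2 ^ j \<le> n" "n < 2 ^ (j + 1)" using ex_power_ivl1[of 2 n] n by auto
    \<comment> \<open>\<open>2 ^ (j + 2)\<close> lies between \<open>2 * n\<close> and
      \<open>4 * n\<close>. For small \<open>n\<close> the subtraction truncates to cycle
      \<open>0\<close>, which the summand \<open>2 ^ i0\<close> in the bound accounts for.\<close>
    define k where "k = Suc (Suc j) - i0"
    have B: "2 ^ (k + i0) \<le> 8 * n + 2 ^ i0" and far: "2 * n \<le> 2 ^ (k + i0)"
    proof -
      have "k + i0 = max (Suc (Suc j)) i0" by (simp add: k_def max_def)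
      moreover have "(2::nat) ^ Suc (Suc j) \<le> 2 ^ max (Suc (Suc j)) i0" by (intro power_increasing) auto
      ultimately show "2 ^ (k + i0) \<le> 8 * n + 2 ^ i0" "2 * n \<le> 2 ^ (k + i0)"
        using j by (auto simp: max_def)
    qed
    have at: "at_real f (8 * real n + 2 ^ i0) = f (8 * n + 2 ^ i0)"
    proof -
      have "8 * real n + 2 ^ i0 = real (8 * n + 2 ^ i0)" by simp
      then show ?thesis unfolding at_real_def by (simp only: ceiling_of_nat nat_int)
    qed
    show ?thesis unfolding at
    proof (rule le[OF n, of k])
      fix i assume "k \<le> i"
      then have "(2::nat) ^ (k + i0) \<le> 2 ^ (i + i0)" by (intro power_increasing) auto
      then have "int (2 * n) \<le> int (2 ^ (i + i0))" using far by (simp only: of_nat_le_iff)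
      then show "2 * int n < 2 ^ (i + i0) + 1" by simp
    next
      fix i assume "i \<le> k"
      then have "(2::nat) ^ (i + i0) \<le> 2 ^ (k + i0)" by (intro power_increasing) auto
      then have "2 ^ (i + i0) \<le> 8 * n + 2 ^ i0" using B by (rule order_trans)
      then have "f (2 ^ (i + i0)) \<le> f (8 * n + 2 ^ i0)" by (intro mono) auto
      then show "nat (2 ^ e i) \<le> 2 * f (8 * n + 2 ^ i0)" using e(2)[of i] by (simp add: nat_power_eq)
    qed
  qed
  show ?thesis
    using G lower upper
    by (intro exI[of _ G] exI[of _ S] exI[of _ "8::real"] exI[of _ "2 ^ i0 :: real"] conjI allI impI) simp_all
qed

end
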